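(* Let $(\mu_n)_{n\ge 1}$ be the sequence of discrete pseudo-probability measures associated with a finitely supported family of real coefficients $\{p_k\}_{k\in\Gamma}$ satisfying $\sum_{k\in\Gamma}p_k=1$, as defined in the context. Suppose the total variation norm $\|\mu_n\|_{\mathrm{TV}}$ is bounded independently of $n$. Then $\mu_n$ converges weakly to a pseudo-probability measure $\mu$.
   Context: Two cases are treated simultaneously. Either $m=1$, $\Gamma=\mathbb{Z}\subset\mathbb{R}$ and $M$ is multiplication by $2$ on $\mathbb{R}$; or $m=2$, $\Gamma=\mathbb{Z}^2\subset\mathbb{R}^2$, where $\mathbb{R}^2$ is identified with $\mathbb{C}$ (so $\Gamma$ is the Gaussian integers), and $M$ is multiplication by $1+i$. The family $\{p_k\}_{k\in\Gamma}$ consists of real numbers, only finitely many nonzero, with $\sum_{k\in\Gamma}p_k=1$. A pseudo-probability measure is a finite signed Borel measure $\mu$ on $\mathbb{R}^m$ with $\mu(\mathbb{R}^m)=1$. Let $\delta_x$ be the unit point mass at $x$, let $D(x)=M^{-1}x$, and let $D_\star$ be the push-forward by $D$ on signed measures. Define $\mu_1=\sum_{k\in\Gamma}p_k\,\delta_{M^{-1}k}$ and, for $n\ge2$, $\mu_n=\mu_1\star D_\star(\mu_{n-1})$, where $\star$ is convolution; equivalently $\mu_n$ is the convolution of $(D_\star)^j(\mu_1)$ for $j=0,\dots,n-1$. Weak convergence of finite signed measures $\nu_n\to\nu$ means $\int f\,d\nu_n\to\int f\,d\nu$ for every bounded continuous real function $f$ on $\mathbb{R}^m$. *)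

theory Defs
  imports "HOL-Analysis.Analysis"
begin

text \<open>A signed measure is represented by its set function \<open>'a set \<Rightarrow> real\<close>. Only its values on
  Borel sets are meaningful, and all notions below depend on these values alone.\<close>

definition finite_signed_measure :: "('a::topological_space set \<Rightarrow> real) \<Rightarrow> bool" where
  "finite_signed_measure \<nu> \<longleftrightarrow> \<nu> {} = 0 \<and>
     (\<forall>A :: nat \<Rightarrow> 'a set. range A \<subseteq> sets borel \<longrightarrow> disjoint_family A \<longrightarrow>
        (\<lambda>i. \<nu> (A i)) sums \<nu> (\<Union>i. A i))"

definition pseudo_probability_measure :: "('a::topological_space set \<Rightarrow> real) \<Rightarrow> bool" where
  "pseudo_probability_measure \<nu> \<longleftrightarrow> finite_signed_measure \<nu> \<and> \<nu> UNIV = 1"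

definition tv_norm :: "('a::topological_space set \<Rightarrow> real) \<Rightarrow> ennreal" where
  "tv_norm \<nu> = (SUP P \<in> {P. finite P \<and> P \<subseteq> sets borel \<and> disjoint P \<and> \<Union>P = UNIV}.
      ennreal (\<Sum>A\<in>P. \<bar>\<nu> A\<bar>))"

text \<open>The Jordan decomposition: \<open>\<nu>\<^sup>+(A)\<close> is the supremum of \<open>\<nu>(B)\<close> over the Borel sets
  \<open>B \<subseteq> A\<close> (nonnegative, since \<open>B = {}\<close> is allowed), and \<open>\<nu>\<^sup>- = (-\<nu>)\<^sup>+\<close>.\<close>

definition jordan_pos :: "('a::topological_space set \<Rightarrow> real) \<Rightarrow> 'a measure" where
  "jordan_pos \<nu> = measure_of UNIV (sets borel)
     (\<lambda>A. SUP B \<in> {B \<in> sets borel. B \<subseteq> A}. ennreal (\<nu> B))"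

definition jordan_neg :: "('a::topological_space set \<Rightarrow> real) \<Rightarrow> 'a measure" where
  "jordan_neg \<nu> = jordan_pos (\<lambda>A. - \<nu> A)"

definition signed_integral ::
    "('a::topological_space set \<Rightarrow> real) \<Rightarrow> ('a \<Rightarrow> real) \<Rightarrow> real" where
  "signed_integral \<nu> f = (LINT x|jordan_pos \<nu>. f x) - (LINT x|jordan_neg \<nu>. f x)"

definition weakly_converges_to ::
    "(nat \<Rightarrow> 'a::topological_space set \<Rightarrow> real) \<Rightarrow> ('a set \<Rightarrow> real) \<Rightarrow> bool" where
  "weakly_converges_to \<nu>s \<nu> \<longleftrightarrow>
     (\<forall>f :: 'a \<Rightarrow> real. continuous_on UNIV f \<longrightarrow> bounded (range f) \<longrightarrow>
        (\<lambda>n. signed_integral (\<nu>s n) f) \<longlonglongrightarrow> signed_integral \<nu> f)"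

definition point_mass :: "'a \<Rightarrow> 'a set \<Rightarrow> real" where
  "point_mass x A = indicator A x"

definition push_forward :: "('a \<Rightarrow> 'b) \<Rightarrow> ('a set \<Rightarrow> real) \<Rightarrow> 'b set \<Rightarrow> real" where
  "push_forward f \<nu> A = \<nu> (f -` A)"

definition signed_convolution ::
    "('a::{topological_space, plus} set \<Rightarrow> real) \<Rightarrow> ('a set \<Rightarrow> real) \<Rightarrow> 'a set \<Rightarrow> real" where
  "signed_convolution \<nu> \<rho> A = signed_integral \<rho> (\<lambda>y. \<nu> {x. x + y \<in> A})"

text \<open>The coefficients \<open>p\<close> are given on the whole space, but only their values on the lattice
  \<open>\<Gamma>\<close> are used.\<close>

definition mu_one :: "'a set \<Rightarrow> ('a \<Rightarrow> 'a) \<Rightarrow> ('a \<Rightarrow> real) \<Rightarrow> 'a set \<Rightarrow> real" where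
  "mu_one \<Gamma> M p A = (\<Sum>k | k \<in> \<Gamma> \<and> p k \<noteq> 0. p k * point_mass (inv M k) A)"

text \<open>The sequence proper starts at index 1; index 0 carries the empty convolution product.\<close>

fun mu :: "'a::real_normed_vector set \<Rightarrow> ('a \<Rightarrow> 'a) \<Rightarrow> ('a \<Rightarrow> real) \<Rightarrow> nat \<Rightarrow> 'a set \<Rightarrow> real" where
  "mu \<Gamma> M p 0 = point_mass 0"
| "mu \<Gamma> M p (Suc 0) = mu_one \<Gamma> M p"
| "mu \<Gamma> M p (Suc (Suc n)) =
     signed_convolution (mu_one \<Gamma> M p) (push_forward (inv M) (mu \<Gamma> M p (Suc n)))"

definition gaussian_integers :: "complex set" where
  "gaussian_integers = {z. Re z \<in> \<int> \<and> Im z \<in> \<int>}"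

end

theory Submission
  imports Defs "HOL-Probability.Helly_Selection"
begin

text \<open>
  Since \<open>\<mu>\<^sub>n\<^sub>+\<^sub>1\<close> is the convolution of \<open>\<mu>\<^sub>n\<close> with a measure of mass one supported at distance
  \<open>O(\<bar>M\<bar>\<^sup>-\<^sup>n)\<close> from the origin, the integrals of a Lipschitz function against \<open>\<mu>\<^sub>n\<close> have geometrically
  decaying increments, by the bound on the total variation. All \<open>\<mu>\<^sub>n\<close> live on one ball, so by
  Stone--Weierstrass and the total variation bound once more, the integrals of every continuous function
  converge. To represent the limit functional by a measure, lift the atoms of \<open>\<mu>\<^sub>n\<close> to \<open>[0,1]\<close> along a
  continuous curve that fills the ball, apply Helly's selection theorem to the positive and the negative
  parts, and push the limits forward along the curve.
\<close>

section \<open>Integration against signed measures\<close>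

text \<open>Both sides are additive, homogeneous and continuous along increasing sequences in
  \<open>f\<close>, so agreement on indicators propagates. Sums of two measures encode an identity
  between differences without subtraction in \<open>ennreal\<close>.\<close>

lemma nn_integral_add_measures_eq:
  assumes sets: "sets Q = sets P" "sets P' = sets P" "sets Q' = sets P"
    and eq: "\<And>A. A \<in> sets P \<Longrightarrow> emeasure P A + emeasure Q A = emeasure P' A + emeasure Q' A"
    and f: "f \<in> borel_measurable P"
  shows "nn_integral P f + nn_integral Q f = nn_integral P' f + nn_integral Q' f"
proof -
  note sp = sets[THEN sets_eq_imp_space_eq]
  have meas: "g \<in> borel_measurable Q" "g \<in> borel_measurable P'" "g \<in> borel_measurable Q'"
    if "g \<in> borel_measurable P" for g :: "'a \<Rightarrow> ennreal"
    using that sets measurable_cong_sets by blast+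
  show ?thesis
    using f
  proof induct
    case (cong f g)
    then have "nn_integral M f = nn_integral M g" if "space M = space P" for M
      using that by (intro nn_integral_cong) auto
    with cong sp show ?case by simp
  next
    case (set A)
    with sets eq show ?case by simp
  next
    case (mult u c)
    then show ?case
      by (simp add: nn_integral_cmult meas distrib_left[symmetric])
  next
    case (add u v)
    have "nn_integral M (\<lambda>x. v x + u x) + nn_integral M' (\<lambda>x. v x + u x)
        = (nn_integral M u + nn_integral M' u) + (nn_integral M v + nn_integral M' v)"
      if "sets M = sets P" "sets M' = sets P" for M M'
    proof -
      have "u \<in> borel_measurable M" "v \<in> borel_measurable M"
        "u \<in> borel_measurable M'" "v \<in> borel_measurable M'"
        using add(1,4) that measurable_cong_sets by blast+
      then show ?thesis
        by (simp add: nn_integral_add ac_simps)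
    qed
    from this[of P Q] this[of P' Q'] show ?case
      by (simp only: sets add)
  next
    case (seq U)
    have lim: "(\<integral>\<^sup>+ x. (SUP i. U i) x \<partial>M) = (SUP i. nn_integral M (U i))"
      if "sets M = sets P" for M
    proof -
      have "\<And>i. U i \<in> borel_measurable M"
        using seq(1) that measurable_cong_sets by blast
      then show ?thesis
        using seq(4) by (simp add: SUP_apply image_comp nn_integral_monotone_convergence_SUP)
    qed
    have inc: "incseq (\<lambda>i. nn_integral M (U i))" for M
      using seq(4) by (auto simp: incseq_def le_fun_def intro!: nn_integral_mono)
    show ?case
      using seq(3) by (simp only: lim[OF refl] lim[OF sets(1)] lim[OF sets(2)] lim[OF sets(3)]
          ennreal_SUP_add[OF inc inc, symmetric])
  qed
qed

text \<open>Shifting \<open>f\<close> by \<open>B\<close> makes it nonnegative; the extra terms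
  cancel because \<open>eq\<close> at \<open>space P\<close> equates the total masses.\<close>

lemma integral_add_measures_eq:
  fixes f :: "'a \<Rightarrow> real"
  assumes fin: "finite_measure P" "finite_measure Q" "finite_measure P'" "finite_measure Q'"
    and sets: "sets Q = sets P" "sets P' = sets P" "sets Q' = sets P"
    and eq: "\<And>A. A \<in> sets P \<Longrightarrow> measure P A + measure Q A = measure P' A + measure Q' A"
    and f: "f \<in> borel_measurable P" and bd: "\<And>x. \<bar>f x\<bar> \<le> B"
  shows "integral\<^sup>L P f + integral\<^sup>L Q f = integral\<^sup>L P' f + integral\<^sup>L Q' f"
proof -
  have nn: "0 \<le> f x + B" for x
    using bd[of x] by linarith
  have B: "0 \<le> B"
    using bd[of undefined] by linarith
  have meas: "f \<in> borel_measurable M" if "sets M = sets P" for M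
    using f that measurable_cong_sets by blast
  have int: "integrable M f" and nnint: "(\<integral>\<^sup>+x. ennreal (f x + B) \<partial>M) = ennreal (integral\<^sup>L M f + B * measure M (space M))"
    and nn_int: "0 \<le> integral\<^sup>L M f + B * measure M (space M)"
    if "finite_measure M" "sets M = sets P" for M
  proof -
    interpret finite_measure M by fact
    show i: "integrable M f"
      using bd by (intro integrable_const_bound[of _ B] meas that) auto
    then have e: "integral\<^sup>L M (\<lambda>x. f x + B) = integral\<^sup>L M f + B * measure M (space M)"
      by (simp add: mult.commute)
    show "(\<integral>\<^sup>+x. ennreal (f x + B) \<partial>M) = ennreal (integral\<^sup>L M f + B * measure M (space M))"
      using i nn by (subst nn_integral_eq_integral) (auto simp: e)
    show "0 \<le> integral\<^sup>L M f + B * measure M (space M)"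
      using nn by (subst e[symmetric]) (intro integral_nonneg_AE; simp)
  qed
  have sp: "space Q = space P" "space P' = space P" "space Q' = space P"
    using sets[THEN sets_eq_imp_space_eq] .
  have "nn_integral P (\<lambda>x. ennreal (f x + B)) + nn_integral Q (\<lambda>x. ennreal (f x + B))
      = nn_integral P' (\<lambda>x. ennreal (f x + B)) + nn_integral Q' (\<lambda>x. ennreal (f x + B))"
  proof (rule nn_integral_add_measures_eq[OF sets])
    fix A assume "A \<in> sets P"
    from eq[OF this] show "emeasure P A + emeasure Q A = emeasure P' A + emeasure Q' A"
      by (simp add: fin finite_measure.emeasure_eq_measure ennreal_plus[symmetric] del: ennreal_plus)
  qed (use f in simp)
  then have "(integral\<^sup>L P f + B * measure P (space P)) + (integral\<^sup>L Q f + B * measure Q (space Q))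
     = (integral\<^sup>L P' f + B * measure P' (space P')) + (integral\<^sup>L Q' f + B * measure Q' (space Q'))"
    using nn_int[OF fin(1)] nn_int[OF fin(2)] nn_int[OF fin(3)] nn_int[OF fin(4)]
    by (simp add: nnint fin sets ennreal_plus[symmetric] del: ennreal_plus)
  moreover have "B * measure P (space P) + B * measure Q (space Q) = B * measure P' (space P') + B * measure Q' (space Q')"
    using eq[of "space P"] by (simp add: sp distrib_left[symmetric])
  ultimately show ?thesis by linarith
qed

text \<open>\<open>Y\<close> is the positive set of a Hahn decomposition of \<open>P - N\<close>.
  The supremum over Borel subsets of \<open>A\<close> is attained at \<open>A \<inter> Y\<close>, so
  the positive part is \<open>P - N\<close> restricted to \<open>Y\<close>.\<close>

lemma jordan_pos_Hahn:
  fixes P N :: "'a::topological_space measure"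
  assumes P: "finite_measure P" "sets P = sets borel"
    and N: "finite_measure N" "sets N = sets borel"
    and \<nu>: "\<And>A. A \<in> sets borel \<Longrightarrow> \<nu> A = measure P A - measure N A"
    and Y: "Y \<in> sets borel"
    and ge: "\<And>X. X \<in> sets borel \<Longrightarrow> X \<subseteq> Y \<Longrightarrow> measure N X \<le> measure P X"
    and le: "\<And>X. X \<in> sets borel \<Longrightarrow> X \<inter> Y = {} \<Longrightarrow> measure P X \<le> measure N X"
  shows "finite_measure (jordan_pos \<nu>)" "sets (jordan_pos \<nu>) = sets borel"
    "\<And>A. A \<in> sets borel \<Longrightarrow> measure (jordan_pos \<nu>) A = measure P (A \<inter> Y) - measure N (A \<inter> Y)"
proof -
  interpret P: finite_measure P by fact
  interpret N: finite_measure N by fact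
  let ?P = "density P (indicator Y)" and ?N = "density N (indicator Y)"
  have YP: "Y \<in> sets P" and YN: "Y \<in> sets N"
    using Y P N by auto
  have eP: "emeasure ?P A = ennreal (measure P (A \<inter> Y))" if "A \<in> sets borel" for A
    using that YP P by (subst emeasure_density)
      (auto simp: indicator_inter_arith[symmetric] P.emeasure_eq_measure mult.commute Int_commute)
  have eN: "emeasure ?N A = ennreal (measure N (A \<inter> Y))" if "A \<in> sets borel" for A
    using that YN N by (subst emeasure_density)
      (auto simp: indicator_inter_arith[symmetric] N.emeasure_eq_measure mult.commute Int_commute)
  have spP: "space P = UNIV" and spN: "space N = UNIV"
    using sets_eq_imp_space_eq[OF P(2)] sets_eq_imp_space_eq[OF N(2)] by simp_all
  have fP: "finite_measure ?P"
    using eP[of UNIV] by (intro finite_measureI) (simp add: spP)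
  have fN: "finite_measure ?N"
    using eN[of UNIV] by (intro finite_measureI) (simp add: spN)
  let ?D = "diff_measure ?P ?N"
  have eD: "emeasure ?D A = ennreal (measure P (A \<inter> Y) - measure N (A \<inter> Y))"
    if "A \<in> sets borel" for A
    using that P N Y ge
    by (subst emeasure_diff_measure[OF fP fN]) (auto simp: eP eN ennreal_minus intro!: ennreal_leI)
  have D: "jordan_pos \<nu> = ?D"
  proof -
    have "(SUP B \<in> {B \<in> sets borel. B \<subseteq> A}. ennreal (\<nu> B)) = emeasure ?D A" if A: "A \<in> sets borel" for A
    proof (rule antisym[OF SUP_least])
      fix B assume "B \<in> {B \<in> sets borel. B \<subseteq> A}"
      then have B: "B \<in> sets borel" "B \<subseteq> A" by auto
      \<comment> \<open>Discarding \<open>B - Y\<close> and adding \<open>(A - B) \<inter> Y\<close>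
        can each only increase \<open>\<nu>\<close>, which leads from \<open>B\<close> to
        \<open>A \<inter> Y\<close>.\<close>
      have AB: "A \<inter> Y = B \<inter> Y \<union> (A - B) \<inter> Y" "B = B \<inter> Y \<union> (B - Y)"
        using B by auto
      have "measure P (A \<inter> Y) = measure P (B \<inter> Y) + measure P ((A - B) \<inter> Y)"
        "measure N (A \<inter> Y) = measure N (B \<inter> Y) + measure N ((A - B) \<inter> Y)"
        using A B Y P N by (subst AB(1); subst P.finite_measure_Union N.finite_measure_Union; auto)+
      moreover have "measure P B = measure P (B \<inter> Y) + measure P (B - Y)"
        "measure N B = measure N (B \<inter> Y) + measure N (B - Y)"
        using A B Y P N
        by (subst P.finite_measure_Union[symmetric] N.finite_measure_Union[symmetric]; auto simp: AB(2)[symmetric])+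
      moreover have "measure N ((A - B) \<inter> Y) \<le> measure P ((A - B) \<inter> Y)" "measure P (B - Y) \<le> measure N (B - Y)"
        using A B Y by (auto intro!: ge le)
      ultimately have "\<nu> B \<le> measure P (A \<inter> Y) - measure N (A \<inter> Y)"
        using \<nu>[OF B(1)] by linarith
      then show "ennreal (\<nu> B) \<le> emeasure ?D A"
        using A by (simp add: eD ennreal_leI)
    next
      show "emeasure ?D A \<le> (SUP B \<in> {B \<in> sets borel. B \<subseteq> A}. ennreal (\<nu> B))"
        using A Y by (intro SUP_upper2[of "A \<inter> Y"]) (auto simp: eD \<nu>)
    qed
    moreover have "space ?D = UNIV" "sets ?D = sets borel"
      using P spP by simp_all
    \<comment> \<open>\<open>measure_of\<close> falls back to the zero measure unless its set
      function is a measure; agreement with \<open>?D\<close> on all Borel sets rules this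
      out.\<close>
    ultimately show ?thesis
      unfolding jordan_pos_def
      by (subst measure_of_of_measure[of ?D, symmetric], simp only:, intro measure_of_eq)
        (auto simp: sets.sigma_sets_eq[of borel, simplified])
  qed
  show s: "sets (jordan_pos \<nu>) = sets borel"
    using P by (simp add: D)
  show "finite_measure (jordan_pos \<nu>)"
    using eD[of UNIV] spP by (intro finite_measureI) (simp add: D)
  show "measure (jordan_pos \<nu>) A = measure P (A \<inter> Y) - measure N (A \<inter> Y)" if "A \<in> sets borel" for A
    using eD[OF that] ge[of "A \<inter> Y"] that Y by (simp add: D measure_def)
qed

text \<open>The Jordan parts satisfy \<open>jordan_pos + N = jordan_neg + P\<close> as measures, so
  any decomposition into finite measures computes the integral and the suprema in the Jordan parts
  never have to be evaluated again.\<close>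

proposition signed_integral_diff:
  fixes P N :: "'a::topological_space measure" and f :: "'a \<Rightarrow> real"
  assumes P: "finite_measure P" "sets P = sets borel"
    and N: "finite_measure N" "sets N = sets borel"
    and \<nu>: "\<And>A. A \<in> sets borel \<Longrightarrow> \<nu> A = measure P A - measure N A"
    and f: "f \<in> borel_measurable borel" and bd: "\<And>x. \<bar>f x\<bar> \<le> B"
  shows "signed_integral \<nu> f = integral\<^sup>L P f - integral\<^sup>L N f"
proof -
  interpret P: finite_measure P by fact
  interpret N: finite_measure N by fact
  obtain Y where Y: "Y \<in> sets borel"
    and "\<And>X. X \<in> sets borel \<Longrightarrow> X \<subseteq> Y \<Longrightarrow> emeasure N X \<le> emeasure P X"
    and "\<And>X. X \<in> sets borel \<Longrightarrow> X \<inter> Y = {} \<Longrightarrow> emeasure P X \<le> emeasure N X"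
    using finite_unsigned_Hahn_decomposition[OF P(1) N(1)] P N by auto
  then have ge: "\<And>X. X \<in> sets borel \<Longrightarrow> X \<subseteq> Y \<Longrightarrow> measure N X \<le> measure P X"
    and le: "\<And>X. X \<in> sets borel \<Longrightarrow> X \<inter> Y = {} \<Longrightarrow> measure P X \<le> measure N X"
    by (simp_all add: P.emeasure_eq_measure N.emeasure_eq_measure)
  have Y': "- Y \<in> sets borel"
    using Y by auto
  note jp = jordan_pos_Hahn[OF P N \<nu> Y ge le]
  \<comment> \<open>The same lemma with \<open>P\<close> and \<open>N\<close> exchanged and
    \<open>- Y\<close> as the positive set.\<close>
  have jn: "finite_measure (jordan_neg \<nu>)" "sets (jordan_neg \<nu>) = sets borel"
    "\<And>A. A \<in> sets borel \<Longrightarrow> measure (jordan_neg \<nu>) A = measure N (A \<inter> - Y) - measure P (A \<inter> - Y)"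
    unfolding jordan_neg_def
    using jordan_pos_Hahn[OF N P _ Y', of "\<lambda>A. - \<nu> A"] \<nu> ge le
    by (auto simp: disjoint_eq_subset_Compl)
  have "integral\<^sup>L (jordan_pos \<nu>) f + integral\<^sup>L N f = integral\<^sup>L (jordan_neg \<nu>) f + integral\<^sup>L P f"
  proof (rule integral_add_measures_eq[where B = B])
    fix A assume "A \<in> sets (jordan_pos \<nu>)"
    then have A: "A \<in> sets borel" by (simp add: jp)
    have eq: "A = A \<inter> Y \<union> A \<inter> - Y" by auto
    have "measure P A = measure P (A \<inter> Y) + measure P (A \<inter> - Y)"
      "measure N A = measure N (A \<inter> Y) + measure N (A \<inter> - Y)"
      using A Y Y' P N
      by (subst P.finite_measure_Union[symmetric] N.finite_measure_Union[symmetric]; auto simp: eq[symmetric])+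
    then show "measure (jordan_pos \<nu>) A + measure N A = measure (jordan_neg \<nu>) A + measure P A"
      using A by (simp add: jp jn)
  next
    show "f \<in> borel_measurable (jordan_pos \<nu>)"
      using f jp(2) measurable_cong_sets by blast
  qed (simp_all add: jp(1,2) jn(1,2) P N bd)
  then show ?thesis
    by (simp add: signed_integral_def)
qed

section \<open>Signed measures with finitely many atoms\<close>

lemma
  fixes h :: "'i \<Rightarrow> 'a::topological_space" and u :: "'i \<Rightarrow> real"
  assumes S: "finite S" and u: "\<And>i. i \<in> S \<Longrightarrow> 0 \<le> u i"
  defines "M \<equiv> distr (point_measure S (\<lambda>i. ennreal (u i))) borel h"
  shows finite_measure_atoms: "finite_measure M"
    and measure_atoms: "A \<in> sets borel \<Longrightarrow> measure M A = (\<Sum>i\<in>S. u i * indicator A (h i))"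
    and integral_atoms: "f \<in> borel_measurable borel \<Longrightarrow> integral\<^sup>L M f = (\<Sum>i\<in>S. u i * f (h i))"
proof -
  have e: "emeasure M A = ennreal (\<Sum>i\<in>S. u i * indicator A (h i))" if A: "A \<in> sets borel" for A
  proof -
    have "emeasure M A = (\<Sum>i\<in>h -` A \<inter> S. ennreal (u i))"
      using A S unfolding M_def
      by (subst emeasure_distr) (auto simp: space_point_measure emeasure_point_measure_finite)
    also have "\<dots> = ennreal (\<Sum>i\<in>h -` A \<inter> S. u i)"
      using u by (intro sum_ennreal) auto
    also have "(\<Sum>i\<in>h -` A \<inter> S. u i) = (\<Sum>i\<in>S. u i * indicator A (h i))"
      using S by (intro sum.mono_neutral_cong_left) (auto simp: indicator_def)
    finally show ?thesis .
  qed
  show "finite_measure M"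
    using e[of UNIV] by (intro finite_measureI) (simp add: M_def)
  show "A \<in> sets borel \<Longrightarrow> measure M A = (\<Sum>i\<in>S. u i * indicator A (h i))"
    using u by (simp add: e measure_def sum_nonneg)
  show "f \<in> borel_measurable borel \<Longrightarrow> integral\<^sup>L M f = (\<Sum>i\<in>S. u i * f (h i))"
    using S u unfolding M_def
    by (subst integral_distr) (auto simp: lebesgue_integral_point_measure_finite)
qed

text \<open>The coefficients are split by sign. If \<open>h\<close> merges indices of opposite sign,
  this is not the Jordan decomposition, but \<open>signed_integral_diff\<close> accepts any
  decomposition.\<close>

lemma signed_integral_atoms:
  fixes h :: "'i \<Rightarrow> 'a::topological_space" and a :: "'i \<Rightarrow> real"
  assumes S: "finite S"
    and \<nu>: "\<And>A. A \<in> sets borel \<Longrightarrow> \<nu> A = (\<Sum>i\<in>S. a i * indicator A (h i))"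
    and f: "f \<in> borel_measurable borel" and bd: "\<And>x. \<bar>f x\<bar> \<le> B"
  shows "signed_integral \<nu> f = (\<Sum>i\<in>S. a i * f (h i))"
proof -
  define P where "P = distr (point_measure S (\<lambda>i. ennreal (max 0 (a i)))) borel h"
  define N where "N = distr (point_measure S (\<lambda>i. ennreal (max 0 (- a i)))) borel h"
  have fin: "finite_measure P" "finite_measure N"
    unfolding P_def N_def by (intro finite_measure_atoms S max.cobounded1)+
  have "measure P A = (\<Sum>i\<in>S. max 0 (a i) * indicator A (h i))"
    "measure N A = (\<Sum>i\<in>S. max 0 (- a i) * indicator A (h i))" if "A \<in> sets borel" for A
    unfolding P_def N_def by (intro measure_atoms S that max.cobounded1)+
  then have "\<nu> A = measure P A - measure N A" if "A \<in> sets borel" for A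
    using that
    by (auto simp: \<nu> sum_subtractf[symmetric] left_diff_distrib[symmetric] max_def intro!: sum.cong)
  then have "signed_integral \<nu> f = integral\<^sup>L P f - integral\<^sup>L N f"
    using fin by (intro signed_integral_diff[OF _ _ _ _ _ f bd]) (auto simp: P_def N_def)
  moreover have "integral\<^sup>L P f = (\<Sum>i\<in>S. max 0 (a i) * f (h i))"
    "integral\<^sup>L N f = (\<Sum>i\<in>S. max 0 (- a i) * f (h i))"
    unfolding P_def N_def by (intro integral_atoms S f max.cobounded1)+
  ultimately show ?thesis
    by (auto simp: sum_subtractf[symmetric] left_diff_distrib[symmetric] max_def intro!: sum.cong)
qed

text \<open>The singletons of \<open>S\<close> together with the complement of \<open>S\<close> form
  a finite Borel partition. \<open>ennreal\<close> truncates a negative \<open>C\<close> to 0, hence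
  \<open>max C 0\<close>.\<close>

lemma sum_abs_le_tv_norm:
  fixes w :: "'a::t1_space \<Rightarrow> real"
  assumes S: "finite S" and \<nu>: "\<And>A. A \<in> sets borel \<Longrightarrow> \<nu> A = (\<Sum>x\<in>S. w x * indicator A x)"
    and C: "tv_norm \<nu> \<le> ennreal C"
  shows "(\<Sum>x\<in>S. \<bar>w x\<bar>) \<le> max C 0"
proof -
  let ?P = "insert (- S) ((\<lambda>x. {x}) ` S)"
  have [measurable]: "S \<in> sets borel"
    using S by (simp add: borel_closed finite_imp_closed)
  have "\<bar>w x\<bar> = \<bar>\<nu> {x}\<bar>" if "x \<in> S" for x
    using S that by (simp add: \<nu> borel_closed indicator_def if_distrib cong: if_cong)
  then have "(\<Sum>x\<in>S. \<bar>w x\<bar>) = (\<Sum>x\<in>S. \<bar>\<nu> {x}\<bar>)"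
    by simp
  also have "\<dots> = (\<Sum>A\<in>(\<lambda>x. {x}) ` S. \<bar>\<nu> A\<bar>)"
    by (subst sum.reindex) auto
  also have "\<dots> \<le> (\<Sum>A\<in>?P. \<bar>\<nu> A\<bar>)"
    using S by (intro sum_mono2) auto
  finally have *: "(\<Sum>x\<in>S. \<bar>w x\<bar>) \<le> (\<Sum>A\<in>?P. \<bar>\<nu> A\<bar>)" .
  have "ennreal (\<Sum>A\<in>?P. \<bar>\<nu> A\<bar>) \<le> tv_norm \<nu>"
    unfolding tv_norm_def
  proof (rule SUP_upper)
    have "- S \<in> sets borel" by measurable
    then show "?P \<in> {P. finite P \<and> P \<subseteq> sets borel \<and> disjoint P \<and> \<Union>P = UNIV}"
      using S by (auto simp: disjoint_def borel_closed)
  qed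
  with C have "ennreal (\<Sum>A\<in>?P. \<bar>\<nu> A\<bar>) \<le> ennreal (max C 0)"
    by (metis dual_order.trans ennreal_leI max.cobounded1)
  then have "(\<Sum>A\<in>?P. \<bar>\<nu> A\<bar>) \<le> max C 0"
    by (subst (asm) ennreal_le_iff) auto
  with * show ?thesis by linarith
qed

section \<open>A space-filling curve\<close>

text \<open>Schoenberg's auxiliary function: continuous, 2-periodic, 0 on [0,1/3] and 1 on [2/3,1].
  Clipping a cosine gives continuity and periodicity at once.\<close>

definition bump :: "real \<Rightarrow> real" where
  "bump t = max 0 (min 1 (1 / 2 - cos (pi * t)))"

lemma bump_bounds: "0 \<le> bump t" "bump t \<le> 1"
  by (auto simp: bump_def)

lemma continuous_on_bump [continuous_intros]:
  fixes f :: "real \<Rightarrow> real"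
  shows "continuous_on S f \<Longrightarrow> continuous_on S (\<lambda>x. bump (f x))"
  unfolding bump_def by (intro continuous_intros)

lemma bump_plus_even: "bump (2 * of_int m + s) = bump s"
proof -
  have "pi * (2 * of_int m + s) = pi * s + 2 * pi * of_int m"
    by (simp add: algebra_simps)
  then show ?thesis
    by (simp add: bump_def cos_add)
qed

lemma bump_eq_0: assumes "0 \<le> s" "s \<le> 1 / 3" shows "bump s = 0"
proof -
  have "cos (pi / 3) \<le> cos (pi * s)"
    using assms by (intro cos_monotone_0_pi_le) (auto simp: field_simps)
  then show ?thesis
    by (simp add: bump_def cos_60)
qed

lemma bump_eq_1: assumes "2 / 3 \<le> s" "s \<le> 1" shows "bump s = 1"
proof -
  have "bump s = max 0 (min 1 (1/2 + cos (pi * (1 - s))))"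
    by (simp add: bump_def right_diff_distrib cos_diff)
  moreover have "cos (pi / 3) \<le> cos (pi * (1 - s))"
    using assms by (intro cos_monotone_0_pi_le) (auto simp: field_simps)
  ultimately show ?thesis
    by (simp add: cos_60)
qed

text \<open>The point of the Cantor set with ternary digits \<open>2 * a j\<close>.\<close>

definition cantor_sum :: "(nat \<Rightarrow> nat) \<Rightarrow> real" where
  "cantor_sum a = (\<Sum>j. 2 * real (a j) / 3 ^ Suc j)"

context
  fixes a :: "nat \<Rightarrow> nat"
  assumes a: "\<And>j. a j \<le> 1"
begin

lemma summable_cantor: "summable (\<lambda>j. 2 * real (a (j + k)) / 3 ^ Suc j)"
proof (rule summable_comparison_test'[of "\<lambda>j. 2 / 3 * (1 / 3) ^ j" 0])
  show "norm (2 * real (a (j + k)) / 3 ^ Suc j) \<le> 2 / 3 * (1 / 3) ^ j" for j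
    using a[of "j + k"] by (simp add: power_one_over field_simps)
qed simp

lemma cantor_sum_bounds: "0 \<le> cantor_sum (\<lambda>j. a (j + k))" "cantor_sum (\<lambda>j. a (j + k)) \<le> 1"
proof -
  show "0 \<le> cantor_sum (\<lambda>j. a (j + k))"
    unfolding cantor_sum_def by (intro suminf_nonneg summable_cantor) simp
  have "cantor_sum (\<lambda>j. a (j + k)) \<le> (\<Sum>j. 2 / 3 * (1 / 3) ^ j)"
    unfolding cantor_sum_def
  proof (intro suminf_le summable_cantor)
    show "2 * real (a (j + k)) / 3 ^ Suc j \<le> 2 / 3 * (1 / 3) ^ j" for j
      using a[of "j + k"] by (simp add: power_one_over field_simps)
  qed simp
  also have "(\<Sum>j. 2 / 3 * (1 / 3 :: real) ^ j) = 1"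
    by (subst suminf_mult) (simp_all add: suminf_geometric)
  finally show "cantor_sum (\<lambda>j. a (j + k)) \<le> 1" .
qed

lemma cantor_sum_shift:
  "3 * cantor_sum (\<lambda>j. a (j + k)) = 2 * real (a k) + cantor_sum (\<lambda>j. a (j + Suc k))"
proof -
  have "cantor_sum (\<lambda>j. a (j + k)) = (\<Sum>j. 2 * real (a (Suc j + k)) / 3 ^ Suc (Suc j)) + 2 * real (a k) / 3"
    unfolding cantor_sum_def using suminf_split_head[OF summable_cantor[of k]] by simp
  also have "(\<Sum>j. 2 * real (a (Suc j + k)) / 3 ^ Suc (Suc j))
      = (\<Sum>j. 1 / 3 * (2 * real (a (j + Suc k)) / 3 ^ Suc j))"
    by (intro suminf_cong) simp
  also have "\<dots> = 1 / 3 * cantor_sum (\<lambda>j. a (j + Suc k))"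
    unfolding cantor_sum_def by (intro suminf_mult summable_cantor)
  finally show ?thesis by simp
qed

text \<open>Multiplication by \<open>3 ^ k\<close> turns the first \<open>k\<close> digits into an
  even integer, invisible to \<open>bump\<close>. The remaining tail lies in [0,1/3] or [2/3,1]
  according to its leading digit.\<close>

lemma bump_cantor_sum: "bump (3 ^ k * cantor_sum a) = real (a k)"
proof -
  have "\<exists>m :: int. 3 ^ k * cantor_sum a = 2 * of_int m + cantor_sum (\<lambda>j. a (j + k))"
  proof (induct k)
    case 0
    show ?case by (auto intro: exI[of _ 0])
  next
    case (Suc k)
    then obtain m :: int where "3 ^ k * cantor_sum a = 2 * of_int m + cantor_sum (\<lambda>j. a (j + k))" ..
    then have "3 ^ Suc k * cantor_sum a
        = 2 * of_int (3 * m + int (a k)) + cantor_sum (\<lambda>j. a (j + Suc k))"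
      using cantor_sum_shift[of k] by simp
    then show ?case ..
  qed
  then obtain m :: int where m: "3 ^ k * cantor_sum a = 2 * of_int m + cantor_sum (\<lambda>j. a (j + k))" ..
  have s: "cantor_sum (\<lambda>j. a (j + k)) = (2 * real (a k) + cantor_sum (\<lambda>j. a (j + Suc k))) / 3"
    using cantor_sum_shift[of k] by simp
  have "a k = 0 \<or> a k = 1"
    using a[of k] by linarith
  then show ?thesis
    using cantor_sum_bounds[of "Suc k"] unfolding m bump_plus_even s
    by (auto intro!: bump_eq_0 bump_eq_1)
qed

end

section \<open>Binary digits and Schoenberg's curve\<close>

lemma binary_expansion:
  fixes u :: real
  assumes "0 \<le> u" "u < 1"
  obtains a :: "nat \<Rightarrow> nat" where "\<And>k. a k \<le> 1" "(\<lambda>k. real (a k) / 2 ^ Suc k) sums u"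
proof
  \<comment> \<open>With digits taken from consecutive floors, the partial sums telescope to
    \<open>b n / 2 ^ n\<close>; \<open>u < 1\<close> enters as \<open>b 0 = 0\<close>.\<close>
  define b where "b k = \<lfloor>2 ^ k * u\<rfloor>" for k
  define a where "a k = nat (b (Suc k) - 2 * b k)" for k
  have b: "0 \<le> b (Suc k) - 2 * b k" "b (Suc k) - 2 * b k \<le> 1" for k
    unfolding b_def by (simp, linarith)+
  have a: "real (a k) = of_int (b (Suc k)) - 2 * of_int (b k)" for k
    using b(1)[of k] by (simp add: a_def)
  show "a k \<le> 1" for k
    using b(2)[of k] by (simp add: a_def)
  have b0: "b 0 = 0"
    using assms by (simp add: b_def floor_eq_iff)
  have "(\<Sum>k<n. real (a k) / 2 ^ Suc k) = of_int (b n) / 2 ^ n" for n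
    by (induct n) (simp_all add: a b0 field_simps)
  moreover have "(\<lambda>n. of_int (b n) / 2 ^ n) \<longlonglongrightarrow> u"
  proof (rule real_tendsto_sandwich)
    show "\<forall>\<^sub>F n in sequentially. u - (1 / 2) ^ n \<le> of_int (b n) / 2 ^ n"
    proof (rule always_eventually, rule allI)
      fix n
      have "(2 ^ n * u - 1) / 2 ^ n \<le> of_int (b n) / 2 ^ n"
        unfolding b_def by (intro divide_right_mono) (linarith, simp)
      then show "u - (1 / 2) ^ n \<le> of_int (b n) / 2 ^ n"
        by (simp add: diff_divide_distrib power_one_over)
    qed
    show "\<forall>\<^sub>F n in sequentially. of_int (b n) / 2 ^ n \<le> u"
      by (rule always_eventually) (auto simp: b_def field_simps)
    show "(\<lambda>n. u - (1 / 2) ^ n) \<longlonglongrightarrow> u"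
      using tendsto_diff[OF tendsto_const LIMSEQ_power_zero[of "1 / 2 :: real"], of u] by simp
  qed simp
  ultimately show "(\<lambda>k. real (a k) / 2 ^ Suc k) sums u"
    by (simp add: sums_def)
qed

text \<open>Schoenberg's space-filling curve is \<open>t \<mapsto> (schoenberg 0 t, schoenberg 1 t)\<close>: at a point of the
  Cantor set the two coordinates read off the even and the odd ternary digits as binary digits.\<close>

definition schoenberg :: "nat \<Rightarrow> real \<Rightarrow> real" where
  "schoenberg i t = (\<Sum>k. bump (3 ^ (2 * k + i) * t) / 2 ^ Suc k)"

lemma continuous_schoenberg: "continuous_on UNIV (schoenberg i)"
proof -
  have "uniform_limit UNIV (\<lambda>n t. \<Sum>k<n. bump (3 ^ (2 * k + i) * t) / 2 ^ Suc k) (schoenberg i) sequentially"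
    unfolding schoenberg_def[abs_def]
  proof (rule Weierstrass_m_test)
    show "norm (bump (3 ^ (2 * k + i) * t) / 2 ^ Suc k) \<le> (1 / 2) ^ Suc k" for k t
      using bump_bounds[of "3 ^ (2 * k + i) * t"] by (simp add: power_one_over field_simps)
    show "summable (\<lambda>k. (1 / 2 :: real) ^ Suc k)"
      by (simp add: summable_Suc_iff)
  qed
  then show ?thesis
    by (rule uniform_limit_theorem[rotated]) (auto intro!: always_eventually continuous_intros)
qed

proposition schoenberg_surj:
  assumes "0 \<le> u" "u < 1" "0 \<le> v" "v < 1"
  obtains t where "0 \<le> t" "t \<le> 1" "schoenberg 0 t = u" "schoenberg 1 t = v"
proof -
  obtain a where a: "\<And>k. a k \<le> 1" "(\<lambda>k. real (a k) / 2 ^ Suc k) sums u"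
    using binary_expansion[OF assms(1,2)] by blast
  obtain b where b: "\<And>k. b k \<le> 1" "(\<lambda>k. real (b k) / 2 ^ Suc k) sums v"
    using binary_expansion[OF assms(3,4)] by blast
  \<comment> \<open>Interleaving: coordinate \<open>i\<close> of the curve reads the digits at
    positions \<open>2 * k + i\<close>.\<close>
  define c where "c k = (if even k then a (k div 2) else b (k div 2))" for k
  have c: "c k \<le> 1" for k
    using a b by (simp add: c_def)
  show ?thesis
  proof
    show "0 \<le> cantor_sum c" "cantor_sum c \<le> 1"
      using cantor_sum_bounds[of c 0] c by auto
    show "schoenberg 0 (cantor_sum c) = u" "schoenberg 1 (cantor_sum c) = v"
      unfolding schoenberg_def bump_cantor_sum[of c, OF c]
      using sums_unique[OF a(2)] sums_unique[OF b(2)] by (simp_all add: c_def)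
  qed
qed

lemma complex_cball_curve:
  obtains g :: "real \<Rightarrow> complex" where "continuous_on UNIV g" "cball 0 R \<subseteq> g ` {0..1}"
proof
  \<comment> \<open>\<open>r\<close> is positive whatever the sign of \<open>R\<close>. Stretching
    to side \<open>4 * r\<close> places the coordinates of the ball in [1/4,3/4], away from the
    value 1 that \<open>schoenberg_surj\<close> excludes.\<close>
  define r where "r = max R 1"
  let ?g = "\<lambda>t. Complex (4 * r * schoenberg 0 t - 2 * r) (4 * r * schoenberg 1 t - 2 * r)"
  have r: "r > 0" "R \<le> r" by (auto simp: r_def)
  show "continuous_on UNIV ?g"
    by (intro continuous_intros continuous_on_Complex continuous_schoenberg)
  show "cball 0 R \<subseteq> ?g ` {0..1}"
  proof
    fix z :: complex assume "z \<in> cball 0 R"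
    then have "\<bar>Re z\<bar> \<le> r" "\<bar>Im z\<bar> \<le> r"
      using abs_Re_le_cmod[of z] abs_Im_le_cmod[of z] r by auto
    then have "0 \<le> (Re z + 2 * r) / (4 * r)" "(Re z + 2 * r) / (4 * r) < 1"
      "0 \<le> (Im z + 2 * r) / (4 * r)" "(Im z + 2 * r) / (4 * r) < 1"
      using r by (auto simp: divide_simps)
    then obtain t where t: "0 \<le> t" "t \<le> 1" "schoenberg 0 t = (Re z + 2 * r) / (4 * r)"
      "schoenberg 1 t = (Im z + 2 * r) / (4 * r)"
      by (rule schoenberg_surj)
    with r have "z = ?g t"
      by (simp add: complex_eq_iff)
    with t show "z \<in> ?g ` {0..1}" by auto
  qed
qed

lemma real_cball_curve:
  obtains g :: "real \<Rightarrow> real" where "continuous_on UNIV g" "cball 0 R \<subseteq> g ` {0..1}"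
proof
  define r where "r = max R 1"
  have r: "r > 0" "R \<le> r" by (auto simp: r_def)
  show "continuous_on UNIV (\<lambda>t. 2 * r * t - r)"
    by (intro continuous_intros)
  show "cball 0 R \<subseteq> (\<lambda>t. 2 * r * t - r) ` {0..1}"
  proof
    fix z :: real assume "z \<in> cball 0 R"
    with r show "z \<in> (\<lambda>t. 2 * r * t - r) ` {0..1}"
      by (intro image_eqI[of _ _ "(z + r) / (2 * r)"]) (auto simp: divide_simps)
  qed
qed

section \<open>Weak limits of atomic signed measures\<close>

text \<open>On the real line the lifted measures all live on [0,1], so they are tight. Testing
  against \<open>f\<close> composed with \<open>g\<close>, which is continuous, transfers the weak
  limit to the image of \<open>g\<close>.\<close>

lemma Helly_atoms:
  fixes g :: "real \<Rightarrow> 'a::euclidean_space"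
  assumes g: "continuous_on UNIV g"
    and S: "\<And>n. finite (S n)" "\<And>n. S n \<subseteq> g ` {0..1}"
    and u: "\<And>n x. x \<in> S n \<Longrightarrow> 0 \<le> u n x" "\<And>n. sum (u n) (S n) = 1"
  obtains r :: "nat \<Rightarrow> nat" and Q :: "'a measure"
  where "strict_mono r" "prob_space Q" "sets Q = sets borel"
    "\<And>f :: 'a \<Rightarrow> real. continuous_on UNIV f \<Longrightarrow> bounded (range f) \<Longrightarrow>
       (\<lambda>n. \<Sum>x\<in>S (r n). u (r n) x * f x) \<longlonglongrightarrow> integral\<^sup>L Q f"
proof -
  \<comment> \<open>A pointwise choice of preimages: it is applied to finitely many atoms at a time,
    and the continuity used later is that of \<open>g\<close>.\<close>
  define h where "h = inv_into {0..1} g"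
  have h: "h x \<in> {0..1}" "g (h x) = x" if "x \<in> S n" for n x
    using S(2)[of n] that unfolding h_def by (blast intro!: inv_into_into f_inv_into_f)+
  define M where "M n = distr (point_measure (S n) (\<lambda>x. ennreal (u n x))) borel h" for n
  have mM: "measure (M n) A = (\<Sum>x\<in>S n. u n x * indicator A (h x))" if "A \<in> sets borel" for n A
    unfolding M_def by (intro measure_atoms S u that)
  have iM: "integral\<^sup>L (M n) f = (\<Sum>x\<in>S n. u n x * f (h x))" if "f \<in> borel_measurable borel" for n f
    unfolding M_def by (intro integral_atoms S u that)
  have rd: "real_distribution (M n)" for n
  proof -
    have "finite_measure (M n)"
      unfolding M_def by (intro finite_measure_atoms S u)
    moreover have "measure (M n) (space (M n)) = 1"
      using mM[of UNIV n] u(2)[of n] by (simp add: M_def)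
    ultimately have "prob_space (M n)"
      by (simp add: finite_measure.emeasure_eq_measure prob_spaceI)
    then show ?thesis
      by (simp add: real_distribution_def real_distribution_axioms_def M_def)
  qed
  \<comment> \<open>Tightness is phrased with intervals open on the left; the left end -1 keeps an
    atom at 0 inside.\<close>
  have one: "measure (M n) {-1<..1} = 1" for n
  proof -
    have "measure (M n) {-1<..1} = sum (u n) (S n)"
      using h(1) by (subst mM) (force intro!: sum.cong)+
    then show ?thesis using u(2) by simp
  qed
  have "\<exists>a b. a < b \<and> (\<forall>n. 1 - \<epsilon> < measure (M n) {a<..b})" if "0 < \<epsilon>" for \<epsilon> :: real
    using one that by (intro exI[of _ "-1"] exI[of _ 1]) simp
  then have "tight M"
    unfolding tight_def using rd by blast
  from tight_imp_convergent_subsubsequence[OF this strict_mono_id]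
  obtain r N where r: "strict_mono r" and N: "real_distribution N" and conv: "weak_conv_m (M \<circ> r) N"
    by auto
  interpret N: real_distribution N by fact
  have gm [measurable]: "g \<in> borel_measurable borel"
    using g by (rule borel_measurable_continuous_onI)
  show ?thesis
  proof
    show "strict_mono r" by fact
    show "prob_space (distr N borel g)"
      by (rule N.prob_space_distr) simp
    show "sets (distr N borel g) = sets borel" by simp
    fix f :: "'a \<Rightarrow> real"
    assume f: "continuous_on UNIV f" "bounded (range f)"
    then obtain B where B: "\<And>x. \<bar>f x\<bar> \<le> B"
      by (auto simp: bounded_iff)
    have fm: "f \<in> borel_measurable borel"
      using f by (intro borel_measurable_continuous_onI)
    have "isCont (\<lambda>t. f (g t)) t" for t
      using continuous_on_compose2[OF f(1) g] continuous_on_eq_continuous_at by blast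
    then have "(\<lambda>n. integral\<^sup>L ((M \<circ> r) n) (\<lambda>t. f (g t))) \<longlonglongrightarrow> integral\<^sup>L N (\<lambda>t. f (g t))"
      using rd N conv B by (intro weak_conv_imp_integral_bdd_continuous_conv) (auto simp: o_def)
    moreover have "integral\<^sup>L ((M \<circ> r) n) (\<lambda>t. f (g t)) = (\<Sum>x\<in>S (r n). u (r n) x * f x)" for n
      using fm h(2) by (simp add: iM)
    moreover have "integral\<^sup>L N (\<lambda>t. f (g t)) = integral\<^sup>L (distr N borel g) f"
      using fm by (subst integral_distr) auto
    ultimately show "(\<lambda>n. \<Sum>x\<in>S (r n). u (r n) x * f x) \<longlonglongrightarrow> integral\<^sup>L (distr N borel g) f"
      by simp
  qed
qed

lemma finite_signed_measure_diff:
  fixes P N :: "'a::topological_space measure"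
  assumes P: "finite_measure P" "sets P = sets borel"
    and N: "finite_measure N" "sets N = sets borel"
  shows "finite_signed_measure (\<lambda>A. measure P A - measure N A)"
proof -
  interpret P: finite_measure P by fact
  interpret N: finite_measure N by fact
  show ?thesis
    unfolding finite_signed_measure_def
    using P.finite_measure_UNION N.finite_measure_UNION P N
    by (auto intro!: sums_diff)
qed

text \<open>Helly selection applies to probability vectors, so both sign parts are padded to
  constant mass and normalised. It is used first for the positive part and then, along the
  subsequence found, for the negative one; the limit has mass
  \<open>D - (D - 1) = 1\<close>.\<close>

lemma bounded_variation_atoms_subseq:
  fixes g :: "real \<Rightarrow> 'a::euclidean_space"
  assumes g: "continuous_on UNIV g"
    and S: "\<And>n. finite (S n)" "\<And>n. S n \<subseteq> g ` {0..1}"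
    and w: "\<And>n. (\<Sum>x\<in>S n. \<bar>w n x\<bar>) \<le> C" "\<And>n. sum (w n) (S n) = 1"
  obtains r :: "nat \<Rightarrow> nat" and \<mu> :: "'a set \<Rightarrow> real"
  where "strict_mono r" "pseudo_probability_measure \<mu>"
    "\<And>f. continuous_on UNIV f \<Longrightarrow> bounded (range f) \<Longrightarrow>
       (\<lambda>n. \<Sum>x\<in>S (r n). w (r n) x * f x) \<longlonglongrightarrow> signed_integral \<mu> f"
proof -
  have "S 0 \<noteq> {}"
    using w(2)[of 0] by auto
  then obtain z where z: "z \<in> g ` {0..1}"
    using S(2)[of 0] by blast
  \<comment> \<open>Large enough that the padding \<open>D - a n\<close> is nonnegative and the
    normalising factor \<open>D - 1\<close> is positive.\<close>
  define D where "D = max C 2"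
  have D: "C \<le> D" "2 \<le> D" by (auto simp: D_def)
  define a where "a n = (\<Sum>x\<in>S n. max 0 (w n x))" for n
  \<comment> \<open>Total mass one ties the negative mass to the positive mass, so the same padding
    makes both constant.\<close>
  have b: "(\<Sum>x\<in>S n. max 0 (- w n x)) = a n - 1" for n
    unfolding a_def w(2)[of n, symmetric] sum_subtractf[symmetric] by (intro sum.cong) auto
  have ab: "a n + (a n - 1) = (\<Sum>x\<in>S n. \<bar>w n x\<bar>)" for n
    unfolding b[symmetric] unfolding a_def sum.distrib[symmetric] by (intro sum.cong) auto
  have aD: "a n \<le> D" for n
    using ab[of n] w(1)[of n] D by linarith
  \<comment> \<open>Adding the same mass \<open>D - a n\<close> at \<open>z\<close> to the positive and the negative part gives them the
    total masses \<open>D\<close> and \<open>D - 1\<close>, independent of \<open>n\<close>, and leaves their difference unchanged.\<close>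
  define u where "u n x = ((if x \<in> S n then max 0 (w n x) else 0) + (if x = z then D - a n else 0)) / D" for n x
  define v where "v n x = ((if x \<in> S n then max 0 (- w n x) else 0) + (if x = z then D - a n else 0)) / (D - 1)" for n x
  define T where "T n = insert z (S n)" for n
  have T: "finite (T n)" "T n \<subseteq> g ` {0..1}" for n
    using S z by (auto simp: T_def)
  have sumT: "(\<Sum>x\<in>T n. (if x \<in> S n then c x else 0) * f x) = (\<Sum>x\<in>S n. c x * f x)" for n and c f :: "'a \<Rightarrow> real"
    using S(1) by (intro sum.mono_neutral_cong_right) (auto simp: T_def)
  have sumz: "(\<Sum>x\<in>T n. (if x = z then c else 0) * f x) = c * f z" for n c and f :: "'a \<Rightarrow> real"
    using S(1) by (subst sum.mono_neutral_right[of _ "{z}"]) (auto simp: T_def)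
  have su: "(\<Sum>x\<in>T n. u n x * f x) = ((\<Sum>x\<in>S n. max 0 (w n x) * f x) + (D - a n) * f z) / D" for n f
    unfolding u_def times_divide_eq_left sum_divide_distrib[symmetric] distrib_right sum.distrib sumT sumz ..
  have sv: "(\<Sum>x\<in>T n. v n x * f x) = ((\<Sum>x\<in>S n. max 0 (- w n x) * f x) + (D - a n) * f z) / (D - 1)" for n f
    unfolding v_def times_divide_eq_left sum_divide_distrib[symmetric] distrib_right sum.distrib sumT sumz ..
  have u: "0 \<le> u n x" "sum (u n) (T n) = 1" and v: "0 \<le> v n x" "sum (v n) (T n) = 1" for n x
    using D aD[of n] su[of n "\<lambda>_. 1"] sv[of n "\<lambda>_. 1"]
    by (auto simp: u_def[of n x] v_def[of n x] b a_def[symmetric])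
  obtain r1 P where r1: "strict_mono r1" and P: "prob_space P" "sets P = sets borel"
    and Plim: "\<And>f :: 'a \<Rightarrow> real. continuous_on UNIV f \<Longrightarrow> bounded (range f) \<Longrightarrow>
       (\<lambda>n. \<Sum>x\<in>T (r1 n). u (r1 n) x * f x) \<longlonglongrightarrow> integral\<^sup>L P f"
    using Helly_atoms[of g T u, OF g T u] by blast
  obtain r2 N where r2: "strict_mono r2" and N: "prob_space N" "sets N = sets borel"
    and Nlim: "\<And>f :: 'a \<Rightarrow> real. continuous_on UNIV f \<Longrightarrow> bounded (range f) \<Longrightarrow>
       (\<lambda>n. \<Sum>x\<in>T (r1 (r2 n)). v (r1 (r2 n)) x * f x) \<longlonglongrightarrow> integral\<^sup>L N f"
    using Helly_atoms[of g "\<lambda>n. T (r1 n)" "\<lambda>n. v (r1 n)", OF g T v] by blast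
  let ?P = "density P (\<lambda>_. ennreal D)" and ?N = "density N (\<lambda>_. ennreal (D - 1))"
  define \<mu> where "\<mu> A = measure ?P A - measure ?N A" for A
  interpret P: prob_space P by fact
  interpret N: prob_space N by fact
  have fin: "finite_measure ?P" "finite_measure ?N"
    by (auto intro!: finite_measureI simp: emeasure_density_const P.emeasure_space_1 N.emeasure_space_1)
  have sets: "sets ?P = sets borel" "sets ?N = sets borel"
    using P N by auto
  have sp: "space P = UNIV" "space N = UNIV"
    using sets_eq_imp_space_eq[OF P(2)] sets_eq_imp_space_eq[OF N(2)] by auto
  show ?thesis
  proof
    show "strict_mono (r1 \<circ> r2)"
      using r1 r2 by (rule strict_mono_o)
    show "pseudo_probability_measure \<mu>"
      unfolding pseudo_probability_measure_def \<mu>_def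
      using finite_signed_measure_diff[OF fin(1) sets(1) fin(2) sets(2)] D P.prob_space N.prob_space
      by (simp add: measure_density_const sp P(2) N(2))
    fix f :: "'a \<Rightarrow> real"
    assume f: "continuous_on UNIV f" "bounded (range f)"
    then obtain B where B: "\<And>x. \<bar>f x\<bar> \<le> B"
      by (auto simp: bounded_iff)
    have fm: "f \<in> borel_measurable borel"
      using f by (intro borel_measurable_continuous_onI)
    then have fm': "f \<in> borel_measurable P" "f \<in> borel_measurable N"
      using P N measurable_cong_sets by blast+
    have int: "signed_integral \<mu> f = D * integral\<^sup>L P f - (D - 1) * integral\<^sup>L N f"
      unfolding \<mu>_def using D
      by (subst signed_integral_diff[OF fin(1) sets(1) fin(2) sets(2) _ fm B])
        (auto simp: integral_density fm')
    have "(\<lambda>n. D * (\<Sum>x\<in>T (r1 (r2 n)). u (r1 (r2 n)) x * f x) - (D - 1) * (\<Sum>x\<in>T (r1 (r2 n)). v (r1 (r2 n)) x * f x))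
        \<longlonglongrightarrow> signed_integral \<mu> f"
      unfolding int
      using LIMSEQ_subseq_LIMSEQ[OF Plim[OF f] r2] Nlim[OF f]
      by (intro tendsto_intros) (auto simp: o_def)
    \<comment> \<open>The factors undo the normalisation, and the two paddings at \<open>z\<close>
      cancel.\<close>
    moreover have "D * (\<Sum>x\<in>T n. u n x * f x) - (D - 1) * (\<Sum>x\<in>T n. v n x * f x) = (\<Sum>x\<in>S n. w n x * f x)" for n
    proof -
      have "D * (\<Sum>x\<in>T n. u n x * f x) - (D - 1) * (\<Sum>x\<in>T n. v n x * f x)
          = (\<Sum>x\<in>S n. max 0 (w n x) * f x) - (\<Sum>x\<in>S n. max 0 (- w n x) * f x)"
        using D by (simp add: su sv)
      also have "\<dots> = (\<Sum>x\<in>S n. w n x * f x)"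
        unfolding sum_subtractf[symmetric] left_diff_distrib[symmetric] by (intro sum.cong) auto
      finally show ?thesis .
    qed
    ultimately show "(\<lambda>n. \<Sum>x\<in>S ((r1 \<circ> r2) n). w ((r1 \<circ> r2) n) x * f x) \<longlonglongrightarrow> signed_integral \<mu> f"
      by simp
  qed
qed

section \<open>The cascade\<close>

text \<open>Induction over polynomial functions. A sup bound on \<open>S\<close> is carried along
  with the Lipschitz constant, since the product case uses both.\<close>

lemma Lipschitz_real_polynomial_function:
  fixes f :: "'a::euclidean_space \<Rightarrow> real"
  assumes "real_polynomial_function f" "bounded S"
  shows "\<exists>L\<ge>0. \<forall>x\<in>S. \<forall>y\<in>S. \<bar>f x - f y\<bar> \<le> L * norm (x - y)"
proof -
  obtain r where r: "\<And>x. x \<in> S \<Longrightarrow> norm x \<le> r"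
    using assms(2) by (auto simp: bounded_iff)
  have "\<exists>L B. 0 \<le> L \<and> 0 \<le> B \<and> (\<forall>x\<in>S. \<bar>f x\<bar> \<le> B) \<and> (\<forall>x\<in>S. \<forall>y\<in>S. \<bar>f x - f y\<bar> \<le> L * norm (x - y))"
    using assms(1)
  proof induct
    case (linear f)
    then obtain K where K: "0 \<le> K" "\<And>x. norm (f x) \<le> norm x * K"
      using bounded_linear.nonneg_bounded by blast
    have "\<bar>f x\<bar> \<le> K * max r 0" if "x \<in> S" for x
      using K(2)[of x] mult_left_mono[OF _ K(1), of "norm x" "max r 0"] r[OF that]
      by (simp add: mult.commute max.coboundedI1)
    moreover have "\<bar>f x - f y\<bar> \<le> K * norm (x - y)" for x y
      using K(2)[of "x - y"] linear by (simp add: mult.commute linear_diff bounded_linear.linear)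
    ultimately show ?case
      using K(1) by (intro exI[of _ K] exI[of _ "K * max r 0"]) auto
  next
    case (const c)
    show ?case
      by (intro exI[of _ 0] exI[of _ "\<bar>c\<bar>"]) auto
  next
    case (add f g)
    obtain L B where f: "0 \<le> L" "0 \<le> B" "\<And>x. x \<in> S \<Longrightarrow> \<bar>f x\<bar> \<le> B"
      "\<And>x y. x \<in> S \<Longrightarrow> y \<in> S \<Longrightarrow> \<bar>f x - f y\<bar> \<le> L * norm (x - y)"
      using add(2) by blast
    obtain L' B' where g: "0 \<le> L'" "0 \<le> B'" "\<And>x. x \<in> S \<Longrightarrow> \<bar>g x\<bar> \<le> B'"
      "\<And>x y. x \<in> S \<Longrightarrow> y \<in> S \<Longrightarrow> \<bar>g x - g y\<bar> \<le> L' * norm (x - y)"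
      using add(4) by blast
    have "\<bar>f x + g x\<bar> \<le> B + B'" if "x \<in> S" for x
      using f(3)[OF that] g(3)[OF that] by linarith
    moreover have "\<bar>(f x + g x) - (f y + g y)\<bar> \<le> (L + L') * norm (x - y)" if "x \<in> S" "y \<in> S" for x y
      using f(4)[OF that] g(4)[OF that] by (simp add: distrib_right)
    ultimately show ?case
      using f(1,2) g(1,2) by (intro exI[of _ "L + L'"] exI[of _ "B + B'"]) simp
  next
    case (mult f g)
    obtain L B where f: "0 \<le> L" "0 \<le> B" "\<And>x. x \<in> S \<Longrightarrow> \<bar>f x\<bar> \<le> B"
      "\<And>x y. x \<in> S \<Longrightarrow> y \<in> S \<Longrightarrow> \<bar>f x - f y\<bar> \<le> L * norm (x - y)"
      using mult(2) by blast
    obtain L' B' where g: "0 \<le> L'" "0 \<le> B'" "\<And>x. x \<in> S \<Longrightarrow> \<bar>g x\<bar> \<le> B'"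
      "\<And>x y. x \<in> S \<Longrightarrow> y \<in> S \<Longrightarrow> \<bar>g x - g y\<bar> \<le> L' * norm (x - y)"
      using mult(4) by blast
    have "\<bar>f x * g x\<bar> \<le> B * B'" if "x \<in> S" for x
      unfolding abs_mult using f(3)[OF that] g(3)[OF that] f(2) by (intro mult_mono) auto
    moreover have "\<bar>f x * g x - f y * g y\<bar> \<le> (B * L' + L * B') * norm (x - y)" if "x \<in> S" "y \<in> S" for x y
    proof -
      have "f x * g x - f y * g y = f x * (g x - g y) + (f x - f y) * g y"
        by (simp add: algebra_simps)
      then have "\<bar>f x * g x - f y * g y\<bar> \<le> \<bar>f x\<bar> * \<bar>g x - g y\<bar> + \<bar>f x - f y\<bar> * \<bar>g y\<bar>"
        by (metis abs_mult abs_triangle_ineq)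
      also have "\<dots> \<le> B * (L' * norm (x - y)) + (L * norm (x - y)) * B'"
        using f g that by (intro add_mono mult_mono) (auto intro!: mult_nonneg_nonneg)
      finally show ?thesis by (simp add: algebra_simps)
    qed
    ultimately show ?case
      using f(1,2) g(1,2) by (intro exI[of _ "B * L' + L * B'"] exI[of _ "B * B'"]) simp
  qed
  then show ?thesis by blast
qed

text \<open>Telescoping against a geometric series. The estimate starts at index 1, where the total
  variation bound starts.\<close>

lemma convergent_if_geometric_increments:
  fixes x :: "nat \<Rightarrow> real"
  assumes "0 \<le> q" "q < 1" "\<And>n. n \<ge> 1 \<Longrightarrow> \<bar>x (Suc n) - x n\<bar> \<le> D * q ^ n"
  shows "convergent x"
proof -
  have "summable (\<lambda>n. D * q ^ n)"
    using assms(1,2) by (intro summable_mult summable_geometric) simp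
  then have "summable (\<lambda>n. x (Suc n) - x n)"
    by (rule summable_comparison_test'[of _ 1]) (unfold real_norm_def, rule assms(3))
  then have "convergent (\<lambda>n. x n - x 0)"
    unfolding summable_iff_convergent sum_lessThan_telescope .
  from convergent_add[OF this convergent_const[of "x 0"]] show ?thesis
    by simp
qed

text \<open>Common setting of both cases: \<open>K\<close> is the support of the coefficients and
  \<open>N\<close> the inverse dilation, a contraction with ratio \<open>q\<close>.\<close>

locale refinement_mask =
  fixes K :: "'a::euclidean_space set" and N :: "'a \<Rightarrow> 'a" and p :: "'a \<Rightarrow> real" and q :: real
  assumes finite_K: "finite K" and sum_p: "sum p K = 1"
    and linear_N: "linear N" and norm_N: "\<And>x. norm (N x) \<le> q * norm x"
    and q: "0 \<le> q" "q < 1"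
begin

text \<open>\<open>cascade n f\<close> is the integral of \<open>f\<close> against \<open>\<mu>\<^sub>n\<close>, with \<open>N = M\<^sup>-\<^sup>1\<close>.\<close>

primrec cascade :: "nat \<Rightarrow> ('a \<Rightarrow> real) \<Rightarrow> real" where
  "cascade 0 f = f 0"
| "cascade (Suc n) f = (\<Sum>k\<in>K. p k * cascade n (\<lambda>y. f (N k + N y)))"

text \<open>The solution of \<open>r = q * (\<Sum>k\<in>K. norm k) + q * r\<close>, chosen so that
  every map \<open>y \<mapsto> N k + N y\<close> with \<open>k \<in> K\<close> preserves the ball of
  radius \<open>r\<close>.\<close>

definition radius :: real where
  "radius = q * (\<Sum>k\<in>K. norm k) / (1 - q)"

lemma radius_nonneg: "0 \<le> radius"
  using q by (auto simp: radius_def intro!: divide_nonneg_nonneg mult_nonneg_nonneg sum_nonneg)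

lemma norm_le_sum: "k \<in> K \<Longrightarrow> norm k \<le> (\<Sum>k\<in>K. norm k)"
  using finite_K by (intro member_le_sum) auto

lemma cball_radius_invariant:
  assumes "k \<in> K" "y \<in> cball 0 radius"
  shows "N k + N y \<in> cball 0 radius"
proof -
  have "norm (N k + N y) \<le> q * norm k + q * norm y"
    using norm_triangle_ineq[of "N k" "N y"] norm_N[of k] norm_N[of y] by linarith
  also have "\<dots> \<le> q * (\<Sum>k\<in>K. norm k) + q * radius"
    using assms q norm_le_sum by (intro add_mono mult_left_mono) auto
  also have "\<dots> = radius"
    using q by (simp add: radius_def field_simps)
  finally show ?thesis by simp
qed

lemma cascade_atoms:
  "\<exists>S w. finite S \<and> S \<subseteq> cball 0 radius \<and> (\<forall>f. cascade n f = (\<Sum>x\<in>S. w x * f x))"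
proof (induct n)
  case 0
  show ?case
    using radius_nonneg by (intro exI[of _ "{0}"] exI[of _ "\<lambda>_. 1"]) auto
next
  case (Suc n)
  then obtain S w where S: "finite S" "S \<subseteq> cball 0 radius" "\<And>f. cascade n f = (\<Sum>x\<in>S. w x * f x)"
    by blast
  define h where "h = (\<lambda>(k, y). N k + N y)"
  define c where "c = (\<lambda>(k, y). p k * w y)"
  have fin: "finite (K \<times> S)"
    using finite_K S by simp
  \<comment> \<open>Pairs with the same image are merged, so that the atoms are distinct points and
    the absolute weights can be compared with the total variation.\<close>
  have "cascade (Suc n) f = (\<Sum>z\<in>h ` (K \<times> S). (\<Sum>i | i \<in> K \<times> S \<and> h i = z. c i) * f z)" for f
  proof -
    have "cascade (Suc n) f = (\<Sum>i\<in>K \<times> S. c i * f (h i))"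
      by (simp add: S(3) sum_distrib_left sum.cartesian_product c_def h_def case_prod_unfold mult.assoc)
    also have "\<dots> = (\<Sum>z\<in>h ` (K \<times> S). \<Sum>i | i \<in> K \<times> S \<and> h i = z. c i * f (h i))"
      by (rule sum.image_gen[OF fin])
    also have "\<dots> = (\<Sum>z\<in>h ` (K \<times> S). (\<Sum>i | i \<in> K \<times> S \<and> h i = z. c i) * f z)"
      by (auto simp: sum_distrib_right intro!: sum.cong)
    finally show ?thesis .
  qed
  moreover have "h ` (K \<times> S) \<subseteq> cball 0 radius"
    using cball_radius_invariant S(2) by (force simp: h_def)
  ultimately show ?case
    using fin by (intro exI conjI allI) (rule finite_imageI, assumption+)
qed

lemma cascade_diff: "cascade n (\<lambda>x. f x - g x) = cascade n f - cascade n g"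
proof -
  obtain S w where "finite S" "S \<subseteq> cball 0 radius" "\<And>f. cascade n f = (\<Sum>x\<in>S. w x * f x)"
    using cascade_atoms[of n] by blast
  then show ?thesis
    by (simp add: right_diff_distrib sum_subtractf)
qed

lemma cascade_sum: "cascade n (\<lambda>x. \<Sum>l\<in>K. c l * F l x) = (\<Sum>l\<in>K. c l * cascade n (F l))"
proof -
  obtain S w where "finite S" "S \<subseteq> cball 0 radius"
    and S: "\<And>f. cascade n f = (\<Sum>x\<in>S. w x * f x)"
    using cascade_atoms[of n] by blast
  have "(\<Sum>x\<in>S. \<Sum>l\<in>K. w x * (c l * F l x)) = (\<Sum>l\<in>K. \<Sum>x\<in>S. c l * (w x * F l x))"
    by (subst sum.swap) (simp add: mult.left_commute)
  then show ?thesis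
    by (simp add: S sum_distrib_left)
qed

lemma cascade_const: "cascade n (\<lambda>_. c) = c"
  by (induct n) (simp_all add: sum_distrib_right[symmetric] sum_p)

text \<open>The recursion of \<open>mu\<close> prepends the coarsest factor; the increment estimate needs the finest
  one split off instead.\<close>

lemma cascade_Suc_right:
  "cascade (Suc n) f = cascade n (\<lambda>x. \<Sum>l\<in>K. p l * f (x + (N ^^ Suc n) l))"
proof (induct n arbitrary: f)
  case 0
  show ?case
    using linear_N by (simp add: linear_0)
next
  case (Suc n)
  have "cascade (Suc (Suc n)) f = (\<Sum>k\<in>K. p k * cascade (Suc n) (\<lambda>y. f (N k + N y)))"
    by (rule cascade.simps(2))
  also have "\<dots> = (\<Sum>k\<in>K. p k * cascade n (\<lambda>x. \<Sum>l\<in>K. p l * f (N k + N (x + (N ^^ Suc n) l))))"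
    by (simp only: Suc)
  also have "\<dots> = cascade (Suc n) (\<lambda>x. \<Sum>l\<in>K. p l * f (x + (N ^^ Suc (Suc n)) l))"
    by (simp add: linear_add[OF linear_N] add.assoc)
  finally show ?case .
qed

section \<open>Convergence of the integrals of continuous functions\<close>

lemma norm_N_funpow: "norm ((N ^^ n) x) \<le> q ^ n * norm x"
proof (induct n)
  case (Suc n)
  have "norm ((N ^^ Suc n) x) \<le> q * norm ((N ^^ n) x)"
    using norm_N by simp
  also have "\<dots> \<le> q * (q ^ n * norm x)"
    using Suc q by (intro mult_left_mono) auto
  finally show ?case by simp
qed simp

text \<open>By \<open>cascade_Suc_right\<close> the increment is \<open>cascade n\<close> of an
  averaged translate of \<open>f\<close> minus \<open>f\<close>. Its size on the ball is of order
  \<open>q ^ n\<close>, and \<open>bd\<close>, the form taken by the total variation bound, turns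
  this into a bound on the increment.\<close>

lemma convergent_cascade_Lipschitz:
  assumes bd: "\<And>n h b. n \<ge> 1 \<Longrightarrow> (\<And>x. x \<in> cball 0 radius \<Longrightarrow> \<bar>h x\<bar> \<le> b) \<Longrightarrow> \<bar>cascade n h\<bar> \<le> C * b"
    and L: "0 \<le> L" "\<And>x y. x \<in> cball 0 (radius + (\<Sum>k\<in>K. norm k)) \<Longrightarrow>
        y \<in> cball 0 (radius + (\<Sum>k\<in>K. norm k)) \<Longrightarrow> \<bar>f x - f y\<bar> \<le> L * norm (x - y)"
  shows "convergent (\<lambda>n. cascade n f)"
proof (rule convergent_if_geometric_increments[OF q])
  fix n :: nat assume n: "n \<ge> 1"
  let ?b = "\<Sum>l\<in>K. \<bar>p l\<bar> * (L * (q ^ n * norm l))"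
  have "\<bar>(\<Sum>l\<in>K. p l * f (x + (N ^^ Suc n) l)) - f x\<bar> \<le> ?b" if x: "x \<in> cball 0 radius" for x
  proof -
    \<comment> \<open>The weights sum to one, so \<open>f x\<close> can be moved inside the
      average.\<close>
    have "(\<Sum>l\<in>K. p l * f (x + (N ^^ Suc n) l)) - f x = (\<Sum>l\<in>K. p l * (f (x + (N ^^ Suc n) l) - f x))"
      by (simp add: right_diff_distrib sum_subtractf sum_distrib_right[symmetric] sum_p)
    also have "\<bar>\<dots>\<bar> \<le> (\<Sum>l\<in>K. \<bar>p l\<bar> * \<bar>f (x + (N ^^ Suc n) l) - f x\<bar>)"
      by (rule order_trans[OF sum_abs]) (simp add: abs_mult)
    also have "\<dots> \<le> ?b"
    proof (intro sum_mono mult_left_mono)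
      fix l assume l: "l \<in> K"
      have *: "norm ((N ^^ Suc n) l) \<le> q ^ n * norm l" "q ^ n * norm l \<le> norm l"
      proof -
        have "q ^ Suc n * norm l \<le> q ^ n * norm l"
          using q by (intro mult_right_mono power_decreasing) auto
        with norm_N_funpow[of "Suc n" l] show "norm ((N ^^ Suc n) l) \<le> q ^ n * norm l"
          by linarith
        show "q ^ n * norm l \<le> norm l"
          using q by (intro mult_left_le_one_le power_le_one) auto
      qed
      have "norm (x + (N ^^ Suc n) l) \<le> norm x + norm ((N ^^ Suc n) l)"
        by (rule norm_triangle_ineq)
      \<comment> \<open>A translate leaves the invariant ball by at most \<open>norm l\<close>;
        hence the larger ball in the Lipschitz assumption.\<close>
      then have "x + (N ^^ Suc n) l \<in> cball 0 (radius + (\<Sum>k\<in>K. norm k))"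
        using x norm_le_sum[OF l] * by simp
      moreover have "x \<in> cball 0 (radius + (\<Sum>k\<in>K. norm k))"
        using x norm_le_sum[OF l] norm_ge_zero[of l] by (simp del: norm_ge_zero)
      ultimately have "\<bar>f (x + (N ^^ Suc n) l) - f x\<bar> \<le> L * norm ((x + (N ^^ Suc n) l) - x)"
        by (rule L(2))
      also have "\<dots> \<le> L * (q ^ n * norm l)"
        using * L(1) by (intro mult_left_mono) (simp_all del: funpow.simps)
      finally show "\<bar>f (x + (N ^^ Suc n) l) - f x\<bar> \<le> L * (q ^ n * norm l)" .
    qed simp
    finally show ?thesis .
  qed
  from bd[OF n this] have "\<bar>cascade (Suc n) f - cascade n f\<bar> \<le> C * ?b"
    unfolding cascade_diff cascade_Suc_right .
  also have "C * ?b = (C * (\<Sum>l\<in>K. \<bar>p l\<bar> * (L * norm l))) * q ^ n"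
    by (simp add: sum_distrib_left sum_distrib_right mult_ac)
  finally show "\<bar>cascade (Suc n) f - cascade n f\<bar> \<le> (C * (\<Sum>l\<in>K. \<bar>p l\<bar> * (L * norm l))) * q ^ n" .
qed

text \<open>Three-epsilon argument: polynomials are Lipschitz on balls and approximate
  \<open>f\<close> uniformly on the invariant ball, and \<open>bd\<close> makes the error uniform in
  \<open>n\<close>.\<close>

lemma convergent_cascade:
  assumes bd: "\<And>n h b. n \<ge> 1 \<Longrightarrow> (\<And>x. x \<in> cball 0 radius \<Longrightarrow> \<bar>h x\<bar> \<le> b) \<Longrightarrow> \<bar>cascade n h\<bar> \<le> C * b"
    and C: "0 < C" and f: "continuous_on UNIV f"
  shows "convergent (\<lambda>n. cascade n f)"
proof (rule Cauchy_convergent, rule metric_CauchyI)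
  fix e :: real assume e: "0 < e"
  let ?e = "e / (3 * C)"
  have "0 < ?e" using e C by simp
  then have "\<exists>h. polynomial_function h \<and> (\<forall>x\<in>cball 0 radius. norm (f x - h x) < ?e)"
    by (rule Stone_Weierstrass_polynomial_function[OF compact_cball continuous_on_subset[OF f subset_UNIV]])
  then obtain h where h: "polynomial_function h" "\<forall>x\<in>cball 0 radius. norm (f x - h x) < ?e"
    by (elim exE conjE)
  have poly: "real_polynomial_function h"
    using h(1) by (simp add: real_polynomial_function_eq)
  obtain L where L: "0 \<le> L" "\<And>x y. x \<in> cball 0 (radius + (\<Sum>k\<in>K. norm k)) \<Longrightarrow>
      y \<in> cball 0 (radius + (\<Sum>k\<in>K. norm k)) \<Longrightarrow> \<bar>h x - h y\<bar> \<le> L * norm (x - y)"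
    using Lipschitz_real_polynomial_function[OF poly bounded_cball] by blast
  have "convergent (\<lambda>n. cascade n h)"
  proof (rule convergent_cascade_Lipschitz[OF _ L])
    show "\<bar>cascade n h'\<bar> \<le> C * b"
      if "n \<ge> 1" "\<And>x. x \<in> cball 0 radius \<Longrightarrow> \<bar>h' x\<bar> \<le> b" for n h' b
      using that by (rule bd)
  qed
  then have "Cauchy (\<lambda>n. cascade n h)"
    by (rule convergent_Cauchy)
  then obtain n0 where n0: "\<And>m n. m \<ge> n0 \<Longrightarrow> n \<ge> n0 \<Longrightarrow> dist (cascade m h) (cascade n h) < e / 3"
    using metric_CauchyD[of "\<lambda>n. cascade n h" "e / 3"] e by auto
  have near: "\<bar>cascade n f - cascade n h\<bar> \<le> e / 3" if "n \<ge> 1" for n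
  proof -
    have "\<bar>cascade n (\<lambda>x. f x - h x)\<bar> \<le> C * ?e"
      using h(2) by (intro bd[OF that]) (auto intro: less_imp_le)
    then show ?thesis
      using C by (simp add: cascade_diff)
  qed
  \<comment> \<open>\<open>max n0 1\<close> because \<open>near\<close> is available from index 1
    on.\<close>
  have "dist (cascade m f) (cascade n f) < e" if "m \<ge> max n0 1" "n \<ge> max n0 1" for m n
  proof -
    have "\<bar>cascade m f - cascade m h\<bar> \<le> e / 3" "\<bar>cascade n f - cascade n h\<bar> \<le> e / 3"
      using that by (intro near; simp)+
    moreover have "\<bar>cascade m h - cascade n h\<bar> < e / 3"
      using n0[of m n] that by (simp add: dist_real_def)
    ultimately show ?thesis
      unfolding dist_real_def by linarith
  qed
  then show "\<exists>n0. \<forall>m\<ge>n0. \<forall>n\<ge>n0. dist (cascade m f) (cascade n f) < e"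
    by blast
qed

end

section \<open>The measures as cascades, and their weak limit\<close>

lemma
  fixes M :: "'a::euclidean_space \<Rightarrow> 'a"
  assumes "refinement_mask {k \<in> \<Gamma>. p k \<noteq> 0} (inv M) p q"
  shows mu_eq_cascade: "A \<in> sets borel \<Longrightarrow>
      mu \<Gamma> M p n A = refinement_mask.cascade {k \<in> \<Gamma>. p k \<noteq> 0} (inv M) p n (indicator A)"
    and signed_integral_mu: "f \<in> borel_measurable borel \<Longrightarrow> (\<And>x. \<bar>f x\<bar> \<le> B) \<Longrightarrow>
      signed_integral (mu \<Gamma> M p n) f = refinement_mask.cascade {k \<in> \<Gamma>. p k \<noteq> 0} (inv M) p n f"
proof -
  interpret refinement_mask "{k \<in> \<Gamma>. p k \<noteq> 0}" "inv M" p q by fact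
  let ?K = "{k \<in> \<Gamma>. p k \<noteq> 0}"
  have meas [measurable]: "inv M \<in> borel_measurable borel"
    using linear_N by (intro borel_measurable_continuous_onI linear_continuous_on linear_conv_bounded_linear[THEN iffD1])
  have one: "mu_one \<Gamma> M p A = (\<Sum>k\<in>?K. p k * indicator A (inv M k))" for A
    by (simp add: mu_one_def point_mass_def)
  \<comment> \<open>By the induction hypothesis and \<open>cascade_atoms\<close> the previous
    measure is atomic, so the convolution integral becomes a finite sum.\<close>
  have mu: "mu \<Gamma> M p n A = cascade n (indicator A)" if "A \<in> sets borel" for n A
    using that
  proof (induct n arbitrary: A)
    case 0
    then show ?case by (simp add: point_mass_def)
  next
    case (Suc m)
    note IH = Suc
    show ?case
    \<comment> \<open>\<open>mu\<close> has a separate clause at index 1; there the cascade starts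
      from the unit mass at 0, which \<open>N\<close> fixes.\<close>
    proof (cases m)
      case 0
      then show ?thesis
        using linear_N by (simp add: one linear_0)
    next
      case (Suc n)
      obtain S w where S: "finite S" and "S \<subseteq> cball 0 radius"
        and w: "\<And>f. cascade (Suc n) f = (\<Sum>x\<in>S. w x * f x)"
        using cascade_atoms[of "Suc n"] by blast
      let ?f = "\<lambda>y. mu_one \<Gamma> M p {x. x + y \<in> A}"
      have f: "?f y = (\<Sum>k\<in>?K. p k * indicator A (inv M k + y))" for y
        by (simp add: one indicator_def)
      have "signed_integral (push_forward (inv M) (mu \<Gamma> M p (Suc n))) ?f = (\<Sum>x\<in>S. w x * ?f (inv M x))"
      proof (rule signed_integral_atoms[OF S])
        fix E :: "'a set" assume "E \<in> sets borel"
        then have "inv M -` E \<in> sets borel"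
          using measurable_sets[OF meas] by simp
        then have "push_forward (inv M) (mu \<Gamma> M p (Suc n)) E = cascade (Suc n) (indicator (inv M -` E))"
          using IH(1) by (simp add: push_forward_def Suc)
        then show "push_forward (inv M) (mu \<Gamma> M p (Suc n)) E = (\<Sum>x\<in>S. w x * indicator E (inv M x))"
          by (simp only: w) (simp add: indicator_def)
      next
        show "?f \<in> borel_measurable borel"
          using IH(2) unfolding f by measurable
        show "\<bar>?f y\<bar> \<le> (\<Sum>k\<in>?K. \<bar>p k\<bar>)" for y
          unfolding f by (rule order_trans[OF sum_abs sum_mono]) (auto simp: indicator_def)
      qed
      also have "\<dots> = cascade (Suc n) (\<lambda>x. ?f (inv M x))"
        by (simp only: w)
      \<comment> \<open>Exchanging the sum over the mask with the cascade gives its defining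
        recursion.\<close>
      also have "\<dots> = cascade (Suc (Suc n)) (indicator A)"
        unfolding f cascade_sum by simp
      finally show ?thesis
        by (simp add: signed_convolution_def Suc)
    qed
  qed
  show "A \<in> sets borel \<Longrightarrow> mu \<Gamma> M p n A = cascade n (indicator A)"
    by (rule mu)
  assume f: "f \<in> borel_measurable borel" "\<And>x. \<bar>f x\<bar> \<le> B"
  obtain S w where S: "finite S" and "S \<subseteq> cball 0 radius"
    and w: "\<And>f. cascade n f = (\<Sum>x\<in>S. w x * f x)"
    using cascade_atoms[of n] by blast
  have "signed_integral (mu \<Gamma> M p n) f = (\<Sum>x\<in>S. w x * f x)"
    by (rule signed_integral_atoms[OF S _ f]) (simp only: mu w)
  then show "signed_integral (mu \<Gamma> M p n) f = cascade n f"
    by (simp add: w)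
qed

text \<open>The integrals converge along the whole sequence, while compactness represents their
  limit along a subsequence by a signed measure; the two limits agree.\<close>

proposition mu_weakly_convergent:
  fixes M :: "'a::euclidean_space \<Rightarrow> 'a"
  assumes mask: "refinement_mask {k \<in> \<Gamma>. p k \<noteq> 0} (inv M) p q"
    and curve: "\<And>R. \<exists>g :: real \<Rightarrow> 'a. continuous_on UNIV g \<and> cball 0 R \<subseteq> g ` {0..1}"
    and tv: "\<And>n. n \<ge> 1 \<Longrightarrow> tv_norm (mu \<Gamma> M p n) \<le> ennreal C"
  shows "\<exists>\<mu>. pseudo_probability_measure \<mu> \<and> weakly_converges_to (mu \<Gamma> M p) \<mu>"
proof -
  interpret refinement_mask "{k \<in> \<Gamma>. p k \<noteq> 0}" "inv M" p q by fact
  \<comment> \<open>\<open>max C 0\<close> is the bound delivered by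
    \<open>sum_abs_le_tv_norm\<close>; adding 1 makes it positive, as
    \<open>convergent_cascade\<close> requires.\<close>
  define C' where "C' = max C 0 + 1"
  have "\<exists>S. \<forall>n. \<exists>w. finite (S n) \<and> S n \<subseteq> cball 0 radius \<and> (\<forall>f. cascade n f = (\<Sum>x\<in>S n. w x * f x))"
    by (intro choice allI cascade_atoms)
  then obtain S where "\<forall>n. \<exists>w. finite (S n) \<and> S n \<subseteq> cball 0 radius \<and> (\<forall>f. cascade n f = (\<Sum>x\<in>S n. w x * f x))" ..
  from choice[OF this] obtain w where
    Sw: "\<forall>n. finite (S n) \<and> S n \<subseteq> cball 0 radius \<and> (\<forall>f. cascade n f = (\<Sum>x\<in>S n. w n x * f x))" ..
  then have S: "finite (S n)" "S n \<subseteq> cball 0 radius"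
    and w: "cascade n f = (\<Sum>x\<in>S n. w n x * f x)" for n f
    by simp_all
  have w_le: "(\<Sum>x\<in>S n. \<bar>w n x\<bar>) \<le> C'" if "n \<ge> 1" for n
  proof -
    have "(\<Sum>x\<in>S n. \<bar>w n x\<bar>) \<le> max C 0"
      using S(1) _ tv[OF that] by (rule sum_abs_le_tv_norm) (simp add: mu_eq_cascade[OF mask] w)
    then show ?thesis by (simp add: C'_def)
  qed
  have w_sum: "sum (w n) (S n) = 1" for n
    using w[of n "\<lambda>_. 1"] by (simp add: cascade_const)
  have bd: "\<bar>cascade n h\<bar> \<le> C' * b" if "n \<ge> 1" "\<And>x. x \<in> cball 0 radius \<Longrightarrow> \<bar>h x\<bar> \<le> b" for n h b
  proof -
    have "0 \<le> b"
      using that(2)[of 0] radius_nonneg by (auto intro: order_trans[OF abs_ge_zero])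
    have "\<bar>cascade n h\<bar> \<le> (\<Sum>x\<in>S n. \<bar>w n x\<bar> * \<bar>h x\<bar>)"
      unfolding w by (rule order_trans[OF sum_abs]) (simp add: abs_mult)
    also have "\<dots> \<le> (\<Sum>x\<in>S n. \<bar>w n x\<bar> * b)"
      using that S(2)[of n] by (intro sum_mono mult_left_mono) auto
    also have "\<dots> \<le> C' * b"
      using w_le[OF that(1)] \<open>0 \<le> b\<close> by (simp add: sum_distrib_right[symmetric] mult_right_mono)
    finally show ?thesis .
  qed
  obtain g :: "real \<Rightarrow> 'a" where g: "continuous_on UNIV g" "cball 0 radius \<subseteq> g ` {0..1}"
    using curve by blast
  \<comment> \<open>The shift by \<open>Suc\<close> skips index 0, to which the bound
    \<open>tv\<close> does not apply.\<close>
  obtain r \<mu> where r: "strict_mono r" and \<mu>: "pseudo_probability_measure \<mu>"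
    and lim: "\<And>f. continuous_on UNIV f \<Longrightarrow> bounded (range f) \<Longrightarrow>
       (\<lambda>n. \<Sum>x\<in>S (Suc (r n)). w (Suc (r n)) x * f x) \<longlonglongrightarrow> signed_integral \<mu> f"
  proof (rule bounded_variation_atoms_subseq[OF g(1), of "\<lambda>n. S (Suc n)" "\<lambda>n. w (Suc n)" C'])
    show "S (Suc n) \<subseteq> g ` {0..1}" for n
      using S(2) g(2) by blast
  qed (use S w_le w_sum in auto)
  have "weakly_converges_to (mu \<Gamma> M p) \<mu>"
    unfolding weakly_converges_to_def
  proof (intro allI impI)
    fix f :: "'a \<Rightarrow> real"
    assume f: "continuous_on UNIV f" "bounded (range f)"
    then obtain B where B: "\<And>x. \<bar>f x\<bar> \<le> B"
      by (auto simp: bounded_iff)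
    have mu_f: "signed_integral (mu \<Gamma> M p n) f = cascade n f" for n
      using f(1) B by (intro signed_integral_mu[OF mask]) (auto intro: borel_measurable_continuous_onI)
    have "convergent (\<lambda>n. cascade n f)"
    proof (rule convergent_cascade[OF _ _ f(1)])
      show "\<bar>cascade n h\<bar> \<le> C' * b"
        if "n \<ge> 1" "\<And>x. x \<in> cball 0 radius \<Longrightarrow> \<bar>h x\<bar> \<le> b" for n h b
        using that by (rule bd)
    qed (simp add: C'_def)
    then obtain l where l: "(\<lambda>n. cascade n f) \<longlonglongrightarrow> l"
      by (auto simp: convergent_def)
    have "strict_mono (\<lambda>n. Suc (r n))"
      using r by (simp add: strict_mono_def)
    from LIMSEQ_subseq_LIMSEQ[OF l this] lim[OF f] have "l = signed_integral \<mu> f"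
      by (auto simp: o_def w[symmetric] intro: LIMSEQ_unique)
    with l show "(\<lambda>n. signed_integral (mu \<Gamma> M p n) f) \<longlonglongrightarrow> signed_integral \<mu> f"
      by (simp add: mu_f)
  qed
  with \<mu> show ?thesis by blast
qed

theorem theorem4:
  "(\<forall>p :: real \<Rightarrow> real.
      finite {k \<in> \<int>. p k \<noteq> 0} \<longrightarrow>
      (\<Sum>k | k \<in> \<int> \<and> p k \<noteq> 0. p k) = 1 \<longrightarrow>
      (\<exists>C :: real. \<forall>n\<ge>1. tv_norm (mu \<int> (\<lambda>x. 2 * x) p n) \<le> ennreal C) \<longrightarrow>
      (\<exists>\<mu>. pseudo_probability_measure \<mu> \<and>
           weakly_converges_to (mu \<int> (\<lambda>x. 2 * x) p) \<mu>))
   \<and>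
   (\<forall>p :: complex \<Rightarrow> real.
      finite {k \<in> gaussian_integers. p k \<noteq> 0} \<longrightarrow>
      (\<Sum>k | k \<in> gaussian_integers \<and> p k \<noteq> 0. p k) = 1 \<longrightarrow>
      (\<exists>C :: real. \<forall>n\<ge>1. tv_norm (mu gaussian_integers (\<lambda>z. (1 + \<i>) * z) p n) \<le> ennreal C) \<longrightarrow>
      (\<exists>\<mu>. pseudo_probability_measure \<mu> \<and>
           weakly_converges_to (mu gaussian_integers (\<lambda>z. (1 + \<i>) * z) p) \<mu>))"
proof (intro conjI allI impI)
  fix p :: "real \<Rightarrow> real"
  assume p: "finite {k \<in> \<int>. p k \<noteq> 0}" "(\<Sum>k | k \<in> \<int> \<and> p k \<noteq> 0. p k) = 1"
    "\<exists>C :: real. \<forall>n\<ge>1. tv_norm (mu \<int> (\<lambda>x. 2 * x) p n) \<le> ennreal C"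
  have "inv (\<lambda>x :: real. 2 * x) = (\<lambda>x. x / 2)"
    by (rule inv_unique_comp) auto
  then have "refinement_mask {k \<in> \<int>. p k \<noteq> 0} (inv (\<lambda>x. 2 * x)) p (1 / 2)"
    using p(1,2) by unfold_locales (auto simp: algebra_simps add_divide_distrib)
  then show "\<exists>\<mu>. pseudo_probability_measure \<mu> \<and> weakly_converges_to (mu \<int> (\<lambda>x. 2 * x) p) \<mu>"
    using p(3) by (auto intro!: mu_weakly_convergent intro: real_cball_curve)
next
  fix p :: "complex \<Rightarrow> real"
  assume p: "finite {k \<in> gaussian_integers. p k \<noteq> 0}" "(\<Sum>k | k \<in> gaussian_integers \<and> p k \<noteq> 0. p k) = 1"
    "\<exists>C :: real. \<forall>n\<ge>1. tv_norm (mu gaussian_integers (\<lambda>z. (1 + \<i>) * z) p n) \<le> ennreal C"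
  have nz: "1 + \<i> \<noteq> 0" "cmod (1 + \<i>) = sqrt 2"
    by (auto simp: complex_eq_iff cmod_def)
  then have "inv (\<lambda>z. (1 + \<i>) * z) = (\<lambda>z. z / (1 + \<i>))"
    by (intro inv_unique_comp) auto
  \<comment> \<open>Division by \<open>1 + \<i>\<close> is linear over the reals and contracts by
    \<open>1 / cmod (1 + \<i>)\<close>.\<close>
  then have "refinement_mask {k \<in> gaussian_integers. p k \<noteq> 0} (inv (\<lambda>z. (1 + \<i>) * z)) p (1 / sqrt 2)"
    using p(1,2) nz by unfold_locales (auto simp: norm_divide add_divide_distrib scaleR_conv_of_real)
  then show "\<exists>\<mu>. pseudo_probability_measure \<mu> \<and> weakly_converges_to (mu gaussian_integers (\<lambda>z. (1 + \<i>) * z) p) \<mu>"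
    using p(3) by (auto intro!: mu_weakly_convergent intro: complex_cball_curve)
qed

end
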